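(* Let $X$ be a finite lattice. Let $A$ be a commutative ring with identity and let $B$ be an $A$-module. Then $\mathcal{M}(X,B)$ is isomorphic, as an $A$-module, to $B^n$, where $n=n(X)<\infty$ is the measurability of $X$. Moreover, the lattice $M3$ is non-measurable, i.e. $n(M3)=0$.
   Context: A finite (nonempty) lattice is bounded, with least element $0_X$ and greatest element $1_X$. A ($B$-valued) measure on a bounded lattice $X$ is a function $\nu:X\to B$ with $\nu(0_X)=0$ and, for all $k\ge 2$ and all $x_1,\dots,x_k\in X$, \[ \nu(x_1\vee\dots\vee x_k)=\sum_{s=1}^k(-1)^{s+1}\sum_{1\leq i_1<\dots<i_s\leq k}\nu(x_{i_1}\wedge\dots\wedge x_{i_s}). \] $\mathcal{M}(X,B)$ is the $A$-module of all $B$-valued measures on $X$ (pointwise operations). $\mathbb{Z}[X]$ is the polynomial ring with one variable for each element of $X$, and $I\subseteq\mathbb{Z}[X]$ is the ideal generated by $0_X$, $1_X-1$, and $x\wedge y-xy$, $x\vee y-x-y+xy$ for all $x,y\in X$. The measurability of $X$ is $n(X)=\operatorname{rk}(\mathbb{Z}[X]/I)$, the rank of $\mathbb{Z}[X]/I$ as a $\mathbb{Z}$-module (and $n(X)=\infty$ if this rank is not finite). A lattice with $n(X)=0$ is called non-measurable. $M3$ is the five-element lattice $\{0,x_1,x_2,x_3,1\}$ in which $x_1,x_2,x_3$ are pairwise incomparable, $x_i\wedge x_j=0$ and $x_i\vee x_j=1$ for $i\ne j$. *)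

theory Defs
  imports
    "HOL-Algebra.Algebraic_Closure_Type"
    "HOL-Library.Poly_Mapping"
    "HOL-Library.Extended_Nat"
begin

definition mod_homs ::
    "('a, 'r) ring_scheme \<Rightarrow> ('a, 'b, 'm) module_scheme \<Rightarrow> ('a, 'c, 'n) module_scheme \<Rightarrow> ('b \<Rightarrow> 'c) set"
  where "mod_homs A M N =
    {f \<in> carrier M \<rightarrow> carrier N.
      (\<forall>u\<in>carrier M. \<forall>v\<in>carrier M. f (u \<oplus>\<^bsub>M\<^esub> v) = f u \<oplus>\<^bsub>N\<^esub> f v) \<and>
      (\<forall>a\<in>carrier A. \<forall>u\<in>carrier M. f (a \<odot>\<^bsub>M\<^esub> u) = a \<odot>\<^bsub>N\<^esub> f u)}"

definition mod_isomorphic ::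
    "('a, 'r) ring_scheme \<Rightarrow> ('a, 'b, 'm) module_scheme \<Rightarrow> ('a, 'c, 'n) module_scheme \<Rightarrow> bool"
  where "mod_isomorphic A M N \<longleftrightarrow>
    (\<exists>f \<in> mod_homs A M N. bij_betw f (carrier M) (carrier N))"

text \<open>
  In the two module records below the multiplicative fields, which the record type inherits
  from rings, have no meaning for a module and are left \<^const>\<open>undefined\<close>.
\<close>

definition mod_power :: "('a, 'b, 'm) module_scheme \<Rightarrow> nat \<Rightarrow> ('a, nat \<Rightarrow> 'b) module"
  where "mod_power B n =
    \<lparr>carrier = {..<n} \<rightarrow>\<^sub>E carrier B,
     monoid.mult = undefined, one = undefined,
     zero = (\<lambda>i\<in>{..<n}. \<zero>\<^bsub>B\<^esub>),
     add = (\<lambda>u v. \<lambda>i\<in>{..<n}. u i \<oplus>\<^bsub>B\<^esub> v i),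
     module.smult = (\<lambda>a u. \<lambda>i\<in>{..<n}. a \<odot>\<^bsub>B\<^esub> u i)\<rparr>"

definition int_independent :: "('g, 'm) ring_scheme \<Rightarrow> 'g set \<Rightarrow> bool"
  where "int_independent G S \<longleftrightarrow>
    (\<forall>c :: 'g \<Rightarrow> int. (\<Oplus>\<^bsub>G\<^esub>s\<in>S. [c s] \<cdot>\<^bsub>G\<^esub> s) = \<zero>\<^bsub>G\<^esub> \<longrightarrow> (\<forall>s\<in>S. c s = 0))"

text \<open>
  The rank of the additive group of \<open>G\<close> as a \<open>\<int>\<close>-module: the maximal number of linearly
  independent elements, and \<open>\<infinity>\<close> if there are arbitrarily large finite independent sets.
\<close>

definition int_rank :: "('g, 'm) ring_scheme \<Rightarrow> enat"
  where "int_rank G =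
    (SUP S \<in> {S. finite S \<and> S \<subseteq> carrier G \<and> int_independent G S}. enat (card S))"

text \<open>
  Index tuples \<open>1 \<le> i\<^sub>1 < \<dots> < i\<^sub>s \<le> k\<close> are represented by the \<open>s\<close>-element
  subsets of \<open>{1..k}\<close>.
\<close>

definition lattice_measure ::
    "('a, 'b, 'm) module_scheme \<Rightarrow> ('x::bounded_lattice \<Rightarrow> 'b) \<Rightarrow> bool"
  where "lattice_measure B \<nu> \<longleftrightarrow>
    (\<forall>x. \<nu> x \<in> carrier B) \<and> \<nu> Orderings.bot = \<zero>\<^bsub>B\<^esub> \<and>
    (\<forall>k\<ge>2. \<forall>x :: nat \<Rightarrow> 'x.
      \<nu> (Sup_fin (x ` {1..k})) =
        (\<Oplus>\<^bsub>B\<^esub>s\<in>{1..k}. [((-1::int) ^ (s + 1))] \<cdot>\<^bsub>B\<^esub>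
          (\<Oplus>\<^bsub>B\<^esub>J\<in>{J. J \<subseteq> {1..k} \<and> card J = s}. \<nu> (Inf_fin (x ` J)))))"

definition measure_module ::
    "'x::bounded_lattice itself \<Rightarrow> ('a, 'b, 'm) module_scheme \<Rightarrow> ('a, 'x \<Rightarrow> 'b) module"
  where "measure_module TX B =
    \<lparr>carrier = {\<nu>. lattice_measure B \<nu>},
     monoid.mult = undefined, one = undefined,
     zero = (\<lambda>_. \<zero>\<^bsub>B\<^esub>),
     add = (\<lambda>\<mu> \<nu> x. \<mu> x \<oplus>\<^bsub>B\<^esub> \<nu> x),
     module.smult = (\<lambda>a \<nu> x. a \<odot>\<^bsub>B\<^esub> \<nu> x)\<rparr>"

text \<open>
  Monomials are finitely supported exponent vectors \<open>'x \<Rightarrow>\<^sub>0 nat\<close>; the convolution product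
  on finitely supported functions from monomials to \<open>int\<close> makes the following type the
  polynomial ring over the integers with one variable for each element of \<open>'x\<close>.
\<close>

type_synonym 'x int_mpoly = "('x \<Rightarrow>\<^sub>0 nat) \<Rightarrow>\<^sub>0 int"

definition Var :: "'x \<Rightarrow> 'x int_mpoly"
  where "Var x = Poly_Mapping.single (Poly_Mapping.single x 1) 1"

definition lattice_ideal :: "'x::bounded_lattice int_mpoly set"
  where "lattice_ideal =
    genideal ring_of_type_algebra
      ({Var Orderings.bot, Var Orderings.top - 1} \<union>
       {Var (inf x y) - Var x * Var y | x y. True} \<union>
       {Var (sup x y) - Var x - Var y + Var x * Var y | x y. True})"

definition measurability :: "'x::bounded_lattice itself \<Rightarrow> enat"
  where "measurability TX =
    int_rank (ring_of_type_algebra Quot (lattice_ideal :: 'x int_mpoly set))"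

datatype m3 = M3_zero | M3_x1 | M3_x2 | M3_x3 | M3_one

instance m3 :: finite
proof
  have "(UNIV :: m3 set) = {M3_zero, M3_x1, M3_x2, M3_x3, M3_one}"
    using m3.exhaust by auto
  then show "finite (UNIV :: m3 set)"
    by (metis finite.emptyI finite_insert)
qed

instantiation m3 :: bounded_lattice
begin

definition bot_m3 :: m3 where "bot_m3 = M3_zero"

definition top_m3 :: m3 where "top_m3 = M3_one"

definition less_eq_m3 :: "m3 \<Rightarrow> m3 \<Rightarrow> bool"
  where "less_eq_m3 x y \<longleftrightarrow> x = y \<or> x = M3_zero \<or> y = M3_one"

definition less_m3 :: "m3 \<Rightarrow> m3 \<Rightarrow> bool"
  where "less_m3 x y \<longleftrightarrow> x \<le> y \<and> x \<noteq> (y :: m3)"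

definition inf_m3 :: "m3 \<Rightarrow> m3 \<Rightarrow> m3"
  where "inf_m3 x y = (if x \<le> y then x else if y \<le> x then y else M3_zero)"

definition sup_m3 :: "m3 \<Rightarrow> m3 \<Rightarrow> m3"
  where "sup_m3 x y = (if x \<le> y then y else if y \<le> x then x else M3_one)"

instance
  by standard
    (auto simp: bot_m3_def top_m3_def less_eq_m3_def less_m3_def inf_m3_def sup_m3_def)

end

end

theory Submission
  imports Defs
begin

text \<open>
  Call \<open>p \<noteq> 0\<close> join-prime if \<open>p \<le> x \<squnion> y\<close> implies \<open>p \<le> x\<close> or \<open>p \<le> y\<close>; the number \<open>n\<close> of such
  elements is the measurability. Both sides of the theorem satisfy
  \<open>x = (x \<sqinter> y) + (x \<sqinter> z) - (x \<sqinter> y \<sqinter> z)\<close> whenever \<open>x \<le> y \<squnion> z\<close>: in the quotient ring this is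
  the product of a relator with \<open>x\<close>, and for a measure it follows by comparing inclusion-exclusion
  for \<open>k = 3\<close> with \<open>k = 2\<close> applied twice. If \<open>x \<noteq> 0\<close> is not join-prime, then \<open>y\<close> and \<open>z\<close> can be
  chosen such that the three meets are strictly below \<open>x\<close>. By induction the join-primes span the
  quotient, and a measure is determined by its values on them.

  Conversely, for join-prime \<open>p\<close> the function \<open>x \<mapsto> [p \<le> x]\<close> is a lattice homomorphism to
  \<open>{0, 1}\<close>. It therefore extends to a ring homomorphism from the quotient to the integers, and
  multiplied by any \<open>b\<close> it is a measure. The matrix \<open>[q \<le> p]\<close> being unitriangular, the
  join-primes are linearly independent in the quotient and the values of a measure on them can be
  prescribed freely. In M3 no element is join-prime.
\<close>

section \<open>Join-prime elements\<close>

definition join_prime :: "'x::bounded_lattice \<Rightarrow> bool"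
  where "join_prime p \<longleftrightarrow> p \<noteq> Orderings.bot \<and> (\<forall>x y. p \<le> sup x y \<longrightarrow> p \<le> x \<or> p \<le> y)"

lemma join_prime_le_sup_iff: "join_prime p \<Longrightarrow> p \<le> sup x y \<longleftrightarrow> p \<le> x \<or> p \<le> y"
  unfolding join_prime_def by (metis le_supI1 le_supI2)

lemma finite_order_induct [case_names less]:
  fixes x :: "'x::{finite, order}"
  assumes "\<And>x. (\<And>y. y < x \<Longrightarrow> P y) \<Longrightarrow> P x"
  shows "P x"
proof (induction x rule: measure_induct_rule[where f = "\<lambda>x. card {y. y < x}"])
  case (less x)
  have "card {z. z < y} < card {z. z < x}" if "y < x" for y
    using that by (intro psubset_card_mono) auto
  then show ?case
    using less assms by blast
qed

text \<open>This one induction serves both the spanning of the quotient and the uniqueness of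
  measures. An element that is neither bottom nor join-prime lies below a join
  \<open>sup y z\<close> without lying below \<open>y\<close> or \<open>z\<close>. The three meets
  are then strictly smaller, so the \<open>cover\<close> case need not mention strictness.\<close>

lemma join_prime_induct [case_names bot join_prime cover]:
  fixes x :: "'x::{finite, bounded_lattice}"
  assumes bot: "P Orderings.bot"
    and join_prime: "\<And>p. join_prime p \<Longrightarrow> P p"
    and cover: "\<And>x y z. x \<le> sup y z \<Longrightarrow> P (inf x y) \<Longrightarrow> P (inf x z) \<Longrightarrow>
      P (inf (inf x y) z) \<Longrightarrow> P x"
  shows "P x"
proof (induction x rule: finite_order_induct)
  case (less x)
  consider "x = Orderings.bot" | "join_prime x"
    | y z where "x \<le> sup y z" "\<not> x \<le> y" "\<not> x \<le> z"
    unfolding join_prime_def by blast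
  then show ?case
  proof cases
    case 3
    have "inf x y < x" "inf x z < x" "inf (inf x y) z < x"
      using 3(2,3) by (auto simp: less_le_not_le intro: le_infI1)
    then show ?thesis
      using cover[OF 3(1)] less.IH by blast
  qed (use bot join_prime in auto)
qed

text \<open>Unitriangularity: in the equation for a maximal element of the support of
  \<open>a\<close>, only the diagonal term survives.\<close>

lemma zeta_injective:
  fixes a :: "'x::order \<Rightarrow> int"
  assumes "finite T" and zeta: "\<And>q. q \<in> T \<Longrightarrow> (\<Sum>p\<in>T. a p * of_bool (q \<le> p)) = 0"
    and "p \<in> T"
  shows "a p = 0"
proof (rule ccontr)
  assume "a p \<noteq> 0"
  then have "finite {p \<in> T. a p \<noteq> 0}" "{p \<in> T. a p \<noteq> 0} \<noteq> {}"
    using assms by auto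
  then obtain q where q: "q \<in> T" "a q \<noteq> 0"
    and max: "\<And>p. p \<in> T \<Longrightarrow> a p \<noteq> 0 \<Longrightarrow> q \<le> p \<Longrightarrow> q = p"
    using finite_has_maximal[of "{p \<in> T. a p \<noteq> 0}"] by blast
  have "(\<Sum>p\<in>T. a p * of_bool (q \<le> p)) = (\<Sum>p\<in>T. if p = q then a q else 0)"
    using max by (intro sum.cong) (auto simp: of_bool_def)
  also have "\<dots> = a q"
    using q assms(1) by simp
  finally show False
    using zeta[OF q(1)] q(2) by simp
qed

section \<open>The rank of the quotient ring\<close>

text \<open>Fraction-free Gaussian elimination over the coordinates in \<open>T\<close>. A pivot
  step removes one vector together with one coordinate, so the vectors stay in the majority.\<close>

lemma int_vectors_dependent:
  fixes v :: "'s \<Rightarrow> 't \<Rightarrow> int"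
  assumes "finite T" "finite S" "card T < card S"
  shows "\<exists>c. (\<exists>s\<in>S. c s \<noteq> 0) \<and> (\<forall>t\<in>T. (\<Sum>s\<in>S. c s * v s t) = 0)"
  using assms
proof (induction T arbitrary: S v rule: finite_induct)
  case empty
  then have "S \<noteq> {}" by auto
  then show ?case by (intro exI[of _ "\<lambda>_. 1"]) auto
next
  case (insert t T)
  show ?case
  proof (cases "\<forall>s\<in>S. v s t = 0")
    case True
    have "card T < card S"
      using insert by simp
    then obtain c where "\<exists>s\<in>S. c s \<noteq> 0" "\<forall>t\<in>T. (\<Sum>s\<in>S. c s * v s t) = 0"
      using insert.IH[OF insert.prems(1)] by blast
    then show ?thesis
      using True by (intro exI[of _ c]) simp
  next
    case False
    then obtain s0 where s0: "s0 \<in> S" "v s0 t \<noteq> 0" by blast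
    let ?S = "S - {s0}"
    \<comment> \<open>Cross-multiplication replaces division: the coordinate \<open>t\<close> of
      every \<open>?w s\<close> vanishes.\<close>
    let ?w = "\<lambda>s t'. v s0 t * v s t' - v s t * v s0 t'"
    have "finite ?S" "card T < card ?S"
      using insert s0 by auto
    from insert.IH[OF this, of ?w] obtain c where c: "\<exists>s\<in>?S. c s \<noteq> 0"
      "\<forall>t'\<in>T. (\<Sum>s\<in>?S. c s * ?w s t') = 0"
      by blast
    \<comment> \<open>The coefficient at the pivot \<open>s0\<close> absorbs the subtracted
      multiples of \<open>v s0\<close>. Hence the \<open>d\<close>-combination of the
      \<open>v s\<close> agrees with the \<open>c\<close>-combination of the \<open>?w s\<close> in
      every coordinate, including \<open>t\<close>.\<close>
    define d where "d s = (if s = s0 then - (\<Sum>s\<in>?S. c s * v s t) else v s0 t * c s)" for s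
    have "(\<Sum>s\<in>S. d s * v s t') = (\<Sum>s\<in>?S. c s * ?w s t')" for t'
    proof -
      have "(\<Sum>s\<in>S. d s * v s t') = d s0 * v s0 t' + (\<Sum>s\<in>?S. d s * v s t')"
        using s0 insert.prems(1) by (simp add: sum.remove)
      also have "(\<Sum>s\<in>?S. d s * v s t') = (\<Sum>s\<in>?S. v s0 t * c s * v s t')"
        by (intro sum.cong) (auto simp: d_def)
      finally show ?thesis
        by (simp add: d_def right_diff_distrib sum_subtractf sum_distrib_right mult.assoc
            mult.left_commute)
    qed
    moreover have "\<exists>s\<in>S. d s \<noteq> 0"
      using c(1) s0 by (auto simp: d_def)
    ultimately show ?thesis
      using c(2) by (intro exI[of _ d]) (auto simp: mult.commute)
  qed
qed

section \<open>Evaluation of polynomials at principal filters\<close>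

text \<open>
  The ring homomorphism with \<open>x \<mapsto> [p \<le> x]\<close> on variables. Exponents do not matter because these
  values are idempotent.
\<close>

definition filter_eval :: "'x::order \<Rightarrow> 'x int_mpoly \<Rightarrow> int"
  where "filter_eval p f =
    (\<Sum>m\<in>Poly_Mapping.keys f. Poly_Mapping.lookup f m * of_bool (\<forall>x\<in>Poly_Mapping.keys m. p \<le> x))"

lemma filter_eval_diff: "filter_eval p (f - g) = filter_eval p f - filter_eval p g"
proof -
  let ?K = "Poly_Mapping.keys f \<union> Poly_Mapping.keys g"
  \<comment> \<open>Cancellation can shrink the support of a difference, so all three evaluations
    are expanded over one common set of monomials.\<close>
  have expand: "filter_eval p h =
      (\<Sum>m\<in>?K. Poly_Mapping.lookup h m * of_bool (\<forall>x\<in>Poly_Mapping.keys m. p \<le> x))"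
    if "Poly_Mapping.keys h \<subseteq> ?K" for h
    unfolding filter_eval_def using that
    by (intro sum.mono_neutral_left) (auto simp: in_keys_iff)
  show ?thesis
    using keys_diff[of f g]
    by (simp add: expand lookup_minus left_diff_distrib sum_subtractf)
qed

lemma filter_eval_zero [simp]: "filter_eval p 0 = 0"
  by (simp add: filter_eval_def)

lemma filter_eval_add: "filter_eval p (f + g) = filter_eval p f + filter_eval p g"
  using filter_eval_diff[of p f "0 - g"] filter_eval_diff[of p 0 g] by simp

lemma filter_eval_sum: "filter_eval p (\<Sum>s\<in>S. f s) = (\<Sum>s\<in>S. filter_eval p (f s))"
  by (induction S rule: infinite_finite_induct) (simp_all add: filter_eval_add)

lemma filter_eval_monom:
  "filter_eval p (frag_of m) = of_bool (\<forall>x\<in>Poly_Mapping.keys m. p \<le> x)"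
  by (simp add: filter_eval_def)

lemma filter_eval_Var [simp]: "filter_eval p (Var x) = of_bool (p \<le> x)"
  using filter_eval_monom[of p "Poly_Mapping.single x 1"] by (simp add: Var_def)

lemma filter_eval_one [simp]: "filter_eval p 1 = 1"
  using filter_eval_monom[of p 0] by simp

lemma frag_of_mult: "frag_of m * frag_of n = frag_of (m + n)"
  by (simp add: mult_single)

text \<open>Polynomials form the free abelian group on the monomials and both sides are additive in
  each factor, so two nested inductions reduce the claim to a pair of monomials. Exponents are
  natural numbers and cannot cancel, so the variables of a product are the union of those of its
  factors.\<close>

lemma filter_eval_mult: "filter_eval p (f * g) = filter_eval p f * filter_eval p g"
proof (induction f rule: frag_induction[OF subset_UNIV, case_names zero one diff])
  case (one m)
  show ?case
  proof (induction g rule: frag_induction[OF subset_UNIV, case_names zero one diff])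
    case (one n)
    have "Poly_Mapping.keys (m + n) = Poly_Mapping.keys m \<union> Poly_Mapping.keys n"
      by (auto simp: in_keys_iff lookup_add)
    then show ?case
      by (auto simp: frag_of_mult filter_eval_monom)
  qed (simp_all add: right_diff_distrib filter_eval_diff)
qed (simp_all add: left_diff_distrib filter_eval_diff)

lemma filter_eval_of_int [simp]: "filter_eval p (of_int c) = c"
proof -
  have "filter_eval p (of_nat n) = int n" for n
    by (induction n) (simp_all add: filter_eval_add)
  then show ?thesis
    using filter_eval_diff[of p 0 "of_nat _"]
    by (cases c rule: int_cases2) (simp_all del: of_nat_Suc)
qed

section \<open>The polynomial ring and the ideal of lattice relations\<close>

abbreviation int_mpoly_ring :: "'x int_mpoly ring"
  where "int_mpoly_ring \<equiv> ring_of_type_algebra"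

lemma carrier_int_mpoly_ring [simp]: "carrier (int_mpoly_ring :: 'x int_mpoly ring) = UNIV"
  and mult_int_mpoly_ring [simp]: "f \<otimes>\<^bsub>int_mpoly_ring\<^esub> g = f * (g :: 'x int_mpoly)"
  and one_int_mpoly_ring [simp]: "\<one>\<^bsub>int_mpoly_ring\<^esub> = (1 :: 'x int_mpoly)"
  and zero_int_mpoly_ring [simp]: "\<zero>\<^bsub>int_mpoly_ring\<^esub> = (0 :: 'x int_mpoly)"
  and add_int_mpoly_ring [simp]: "f \<oplus>\<^bsub>int_mpoly_ring\<^esub> g = f + (g :: 'x int_mpoly)"
  by (simp_all add: ring_of_type_algebra_def)

lemma cring_int_mpoly_ring: "cring (int_mpoly_ring :: 'x int_mpoly ring)"
  by (rule cring_from_type_algebra)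

interpretation int_mpoly: cring "int_mpoly_ring :: 'x int_mpoly ring"
  by (rule cring_int_mpoly_ring)

lemma uminus_int_mpoly_ring [simp]: "\<ominus>\<^bsub>int_mpoly_ring\<^esub> f = - (f :: 'x int_mpoly)"
  by (rule int_mpoly.minus_equality) simp_all

definition lattice_relators :: "'x::bounded_lattice int_mpoly set"
  where "lattice_relators =
      {Var Orderings.bot, Var Orderings.top - 1} \<union>
       {Var (inf x y) - Var x * Var y | x y. True} \<union>
       {Var (sup x y) - Var x - Var y + Var x * Var y | x y. True}"

lemma lattice_ideal_genideal: "lattice_ideal = genideal int_mpoly_ring lattice_relators"
  by (simp add: lattice_ideal_def lattice_relators_def)

lemma ideal_lattice_ideal: "ideal (lattice_ideal :: 'x::bounded_lattice int_mpoly set) int_mpoly_ring"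
  unfolding lattice_ideal_def by (rule int_mpoly.genideal_ideal) simp

lemma lattice_ideal_zero [simp]: "0 \<in> (lattice_ideal :: 'x int_mpoly set)"
  and lattice_ideal_add: "f \<in> lattice_ideal \<Longrightarrow> g \<in> lattice_ideal \<Longrightarrow> f + g \<in> lattice_ideal"
  and lattice_ideal_uminus: "f \<in> lattice_ideal \<Longrightarrow> - f \<in> lattice_ideal"
  and lattice_ideal_mult: "f \<in> lattice_ideal \<Longrightarrow> f * g \<in> lattice_ideal"
  for f g :: "'x::bounded_lattice int_mpoly"
proof -
  interpret ideal "lattice_ideal :: 'x int_mpoly set" int_mpoly_ring
    by (rule ideal_lattice_ideal)
  show "0 \<in> (lattice_ideal :: 'x int_mpoly set)"
    using zero_closed by simp
  show "f + g \<in> lattice_ideal" if "f \<in> lattice_ideal" "g \<in> lattice_ideal"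
    using a_closed that by fastforce
  show "- f \<in> lattice_ideal" if "f \<in> lattice_ideal"
    using a_inv_closed that by fastforce
  show "f * g \<in> lattice_ideal" if "f \<in> lattice_ideal"
    using I_r_closed that by fastforce
qed

lemma lattice_ideal_diff: "f \<in> lattice_ideal \<Longrightarrow> g \<in> lattice_ideal \<Longrightarrow> f - g \<in> lattice_ideal"
  using lattice_ideal_add[of f "- g"] lattice_ideal_uminus[of g] by simp

lemma lattice_ideal_relators: "f \<in> lattice_relators \<Longrightarrow> f \<in> lattice_ideal"
  unfolding lattice_ideal_genideal using int_mpoly.genideal_self[of lattice_relators] by auto

text \<open>The kernel of the evaluation is an ideal, and join-primality puts the generators into
  it: the join relator evaluates to zero exactly because \<open>p\<close> lies below a join only if
  it lies below one of the joinands.\<close>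

lemma filter_eval_lattice_ideal:
  assumes "join_prime p" "f \<in> lattice_ideal"
  shows "filter_eval p f = 0"
proof -
  have "ideal {f. filter_eval p f = 0} int_mpoly_ring"
  proof (rule idealI)
    show "subgroup {f. filter_eval p f = 0} (add_monoid int_mpoly_ring)"
    proof (rule group.subgroupI)
      show "group (add_monoid (int_mpoly_ring :: 'a int_mpoly ring))"
        by (rule int_mpoly.a_group)
      show "{f. filter_eval p f = 0} \<noteq> {}"
        using filter_eval_zero by blast
      fix f assume "f \<in> {f. filter_eval p f = 0}"
      then show "inv\<^bsub>add_monoid int_mpoly_ring\<^esub> f \<in> {f. filter_eval p f = 0}"
        using filter_eval_diff[of p 0 f] uminus_int_mpoly_ring[of f, unfolded a_inv_def]
        by simp
    qed (simp_all add: filter_eval_add)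
  qed (simp_all add: filter_eval_mult int_mpoly.ring_axioms)
  moreover have "lattice_relators \<subseteq> {f. filter_eval p f = 0}"
    using assms(1) join_prime_le_sup_iff[OF assms(1)] unfolding lattice_relators_def
    by (auto simp: filter_eval_diff filter_eval_add filter_eval_mult bot_unique join_prime_def)
  ultimately show ?thesis
    using assms(2) int_mpoly.genideal_minimal unfolding lattice_ideal_genideal by blast
qed

section \<open>Join-primes span the quotient\<close>

lemma join_prime_span_Var:
  fixes x :: "'x::{finite, bounded_lattice}"
  shows "\<exists>a. Var x - (\<Sum>p\<in>Collect join_prime. of_int (a p) * Var p) \<in> lattice_ideal"
proof (induction x rule: join_prime_induct)
  case bot
  have "Var Orderings.bot \<in> (lattice_ideal :: 'x int_mpoly set)"
    by (rule lattice_ideal_relators) (simp add: lattice_relators_def)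
  then show ?case
    by (intro exI[of _ "\<lambda>_. 0"]) simp
next
  case (join_prime p)
  have "(\<Sum>q\<in>Collect join_prime. of_int (of_bool (q = p)) * Var q) = Var p"
    using join_prime by (simp add: of_bool_def if_distrib[of of_int] if_distrib[of "\<lambda>c. c * _"] cong: if_cong)
  then show ?case
    by (intro exI[of _ "\<lambda>q. of_bool (q = p)"]) (simp del: of_int_of_bool)
next
  case (cover x y z)
  let ?L = "\<lambda>a. \<Sum>p\<in>Collect join_prime. of_int (a p) * Var p :: 'x int_mpoly"
  from cover obtain a b c where abc: "Var (inf x y) - ?L a \<in> lattice_ideal"
    "Var (inf x z) - ?L b \<in> lattice_ideal" "Var (inf (inf x y) z) - ?L c \<in> lattice_ideal"
    by blast
  have meet: "Var (inf u v) - Var u * Var v \<in> lattice_ideal" for u v :: 'x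
    by (rule lattice_ideal_relators) (auto simp: lattice_relators_def)
  have join: "Var (sup u v) - Var u - Var v + Var u * Var v \<in> lattice_ideal" for u v :: 'x
    by (rule lattice_ideal_relators) (auto simp: lattice_relators_def)
  \<comment> \<open>The join relator for \<open>y\<close> and \<open>z\<close> is multiplied by
    \<open>Var x\<close>, and meet relators turn the resulting products into variables. Since
    \<open>x\<close> lies below \<open>sup y z\<close>, its meet with that join is \<open>x\<close>
    itself.\<close>
  have "Var x - Var (inf x y) - Var (inf x z) + Var (inf (inf x y) z) =
     (Var (inf x (sup y z)) - Var x * Var (sup y z))
     + (Var (sup y z) - Var y - Var z + Var y * Var z) * Var x
     - (Var (inf x y) - Var x * Var y) - (Var (inf x z) - Var x * Var z)
     + (Var (inf (inf x y) z) - Var (inf x y) * Var z) + (Var (inf x y) - Var x * Var y) * Var z"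
    using cover(1) by (simp add: inf_absorb1 algebra_simps)
  also have "\<dots> \<in> lattice_ideal"
    by (intro lattice_ideal_add lattice_ideal_diff lattice_ideal_mult meet join)
  finally have "Var x - Var (inf x y) - Var (inf x z) + Var (inf (inf x y) z) \<in> lattice_ideal" .
  then have "(Var x - Var (inf x y) - Var (inf x z) + Var (inf (inf x y) z))
      + (Var (inf x y) - ?L a) + (Var (inf x z) - ?L b) - (Var (inf (inf x y) z) - ?L c)
      \<in> lattice_ideal"
    by (rule lattice_ideal_diff[OF lattice_ideal_add[OF lattice_ideal_add[OF _ abc(1)] abc(2)] abc(3)])
  moreover have "?L (\<lambda>p. a p + b p - c p) = ?L a + ?L b - ?L c"
    by (simp add: algebra_simps sum.distrib sum_subtractf)
  moreover have "Var x - (A + B - C) =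
      (Var x - u - v + w) + (u - A) + (v - B) - (w - C)" for A B C u v w :: "'x int_mpoly"
    by (simp add: algebra_simps)
  ultimately show ?case
    by (intro exI[of _ "\<lambda>p. a p + b p - c p"]) (simp only:)
qed

text \<open>A product of variables is congruent to the variable of their meet, and the empty product
  to that of the top element.\<close>

lemma monom_cong_Var:
  "\<exists>x :: 'x::bounded_lattice. frag_of m - Var x \<in> lattice_ideal"
proof -
  let ?C = "\<lambda>m. \<exists>x :: 'x. frag_of m - Var x \<in> lattice_ideal"
  have zero: "?C 0"
  proof -
    have "Var Orderings.top - 1 \<in> (lattice_ideal :: 'x int_mpoly set)"
      by (rule lattice_ideal_relators) (simp add: lattice_relators_def)
    from lattice_ideal_uminus[OF this] show ?thesis
      by (intro exI[of _ Orderings.top]) simp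
  qed
  have plus: "?C (m + n)" if "?C m" "?C n" for m n
  proof -
    from that obtain x y where x: "frag_of m - Var x \<in> lattice_ideal"
      and y: "frag_of n - Var y \<in> lattice_ideal"
      by blast
    have meet: "Var (inf x y) - Var x * Var y \<in> lattice_ideal"
      by (rule lattice_ideal_relators) (auto simp: lattice_relators_def)
    have "frag_of (m + n) - Var (inf x y) = (frag_of m - Var x) * frag_of n
        + (frag_of n - Var y) * Var x - (Var (inf x y) - Var x * Var y)"
      unfolding frag_of_mult[symmetric] by (simp add: algebra_simps)
    also have "\<dots> \<in> lattice_ideal"
      by (intro lattice_ideal_diff lattice_ideal_add lattice_ideal_mult x y meet)
    finally show ?thesis by blast
  qed
  have single: "?C (Poly_Mapping.single x n)" for x n
  proof (induction n)
    case (Suc n)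
    have "?C (Poly_Mapping.single x 1)"
      by (intro exI[of _ x]) (simp add: Var_def)
    from plus[OF Suc this] show ?case
      by (simp flip: single_add)
  qed (use zero in simp)
  show ?thesis
  proof (induction m rule: update_induct)
    case (update m x n)
    \<comment> \<open>The induction only adds a variable \<open>x\<close> not yet occurring in
      \<open>m\<close>, so updating the exponent is the same as adding a power of
      \<open>x\<close>.\<close>
    then have "Poly_Mapping.update x n m = m + Poly_Mapping.single x n"
      by (intro poly_mapping_eqI) (auto simp: lookup_update lookup_add lookup_single in_keys_iff)
    then show ?case
      using plus[OF update.IH single] by simp
  qed (use zero in simp)
qed

lemma join_prime_span:
  fixes f :: "'x::{finite, bounded_lattice} int_mpoly"
  shows "\<exists>a. f - (\<Sum>p\<in>Collect join_prime. of_int (a p) * Var p) \<in> lattice_ideal"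
proof (induction f rule: frag_induction[OF subset_UNIV, case_names zero one diff])
  case zero
  show ?case by (intro exI[of _ "\<lambda>_. 0"]) simp
next
  case (one m)
  obtain x :: 'x where x: "frag_of m - Var x \<in> lattice_ideal"
    using monom_cong_Var by blast
  obtain a where "Var x - (\<Sum>p\<in>Collect join_prime. of_int (a p) * Var p) \<in> lattice_ideal"
    using join_prime_span_Var by blast
  from lattice_ideal_add[OF x this] show ?case
    by (intro exI[of _ a]) simp
next
  case (diff f g)
  then obtain a b where
    a: "f - (\<Sum>p\<in>Collect join_prime. of_int (a p) * Var p) \<in> lattice_ideal" and
    b: "g - (\<Sum>p\<in>Collect join_prime. of_int (b p) * Var p) \<in> lattice_ideal"
    by blast
  from lattice_ideal_diff[OF a b] show ?case
    by (intro exI[of _ "\<lambda>p. a p - b p"]) (simp add: left_diff_distrib sum_subtractf algebra_simps)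
qed

lemma filter_eval_combination:
  "filter_eval q (\<Sum>s\<in>S. of_int (c s) * f s) = (\<Sum>s\<in>S. c s * filter_eval q (f s))"
  by (simp add: filter_eval_sum filter_eval_mult)

text \<open>The evaluations at join-primes embed the quotient into integer vectors. If they all
  vanish on \<open>f\<close>, the coefficients of its expansion in join-primes solve the homogeneous
  zeta system and are therefore zero.\<close>

lemma lattice_ideal_iff:
  fixes f :: "'x::{finite, bounded_lattice} int_mpoly"
  shows "f \<in> lattice_ideal \<longleftrightarrow> (\<forall>p. join_prime p \<longrightarrow> filter_eval p f = 0)"
proof
  assume f: "\<forall>p. join_prime p \<longrightarrow> filter_eval p f = 0"
  obtain a where a: "f - (\<Sum>p\<in>Collect join_prime. of_int (a p) * Var p) \<in> lattice_ideal"
    using join_prime_span by blast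
  have "(\<Sum>p\<in>Collect join_prime. a p * of_bool (q \<le> p)) = 0" if "join_prime q" for q
    using filter_eval_lattice_ideal[OF that a] f that
    by (simp add: filter_eval_diff filter_eval_combination)
  then have "a p = 0" if "join_prime p" for p
    using zeta_injective[of "Collect join_prime" a p] that by simp
  with a show "f \<in> lattice_ideal"
    by simp
qed (use filter_eval_lattice_ideal in blast)

section \<open>Independence and rank in the quotient\<close>

abbreviation measure_ring :: "'x::bounded_lattice int_mpoly set ring"
  where "measure_ring \<equiv> int_mpoly_ring Quot lattice_ideal"

abbreviation measure_class :: "'x::bounded_lattice int_mpoly \<Rightarrow> 'x int_mpoly set"
  where "measure_class f \<equiv> lattice_ideal +>\<^bsub>int_mpoly_ring\<^esub> f"

lemma measure_class_hom:
  "ring_hom_ring int_mpoly_ring (measure_ring :: 'x::bounded_lattice int_mpoly set ring) measure_class"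
  by (rule ideal.rcos_ring_hom_ring[OF ideal_lattice_ideal])

lemma add_pow_int_mpoly_ring:
  "[c] \<cdot>\<^bsub>int_mpoly_ring\<^esub> f = of_int c * (f :: 'x int_mpoly)" for c :: int
proof -
  have nat: "[n] \<cdot>\<^bsub>int_mpoly_ring\<^esub> f = of_nat n * f" for n :: nat
    by (induction n) (simp_all add: algebra_simps)
  show ?thesis
    by (cases "c \<ge> 0") (simp_all add: add_pow_int_ge add_pow_int_lt nat)
qed

lemma measure_class_combination:
  fixes f :: "'s \<Rightarrow> 'x::bounded_lattice int_mpoly" and c :: "'s \<Rightarrow> int"
  shows "measure_class (\<Sum>s\<in>S. of_int (c s) * f s) =
    (\<Oplus>\<^bsub>measure_ring\<^esub>s\<in>S. [c s] \<cdot>\<^bsub>measure_ring\<^esub> measure_class (f s))"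
proof -
  interpret ring_hom_ring int_mpoly_ring measure_ring "measure_class :: 'x int_mpoly \<Rightarrow> _"
    by (rule measure_class_hom)
  have smult: "measure_class (of_int k * g) = [k] \<cdot>\<^bsub>measure_ring\<^esub> measure_class g"
    for k :: int and g :: "'x int_mpoly"
    using group_hom.hom_int_pow[OF a_group_hom, of g k]
    unfolding add_pow_int_mpoly_ring[symmetric] by (simp add: add_pow_def)
  have closed: "measure_class g \<in> carrier measure_ring" for g :: "'x int_mpoly"
    using hom_closed by simp
  show ?thesis
  proof (induction S rule: infinite_finite_induct)
    case (insert s S)
    then show ?case
      using hom_add closed
      by (simp add: S.finsum_insert Pi_def smult flip: smult)
  qed (use hom_zero in simp_all)
qed

lemma measure_class_eq_zero_iff:
  fixes f :: "'x::bounded_lattice int_mpoly"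
  shows "measure_class f = \<zero>\<^bsub>measure_ring\<^esub> \<longleftrightarrow> f \<in> lattice_ideal"
proof -
  interpret ideal "lattice_ideal :: 'x int_mpoly set" int_mpoly_ring
    by (rule ideal_lattice_ideal)
  show ?thesis
    using rcos_const_imp_mem[of f] a_rcos_const[of f] by (auto simp: FactRing_def)
qed

text \<open>Moves independence of classes to their integer evaluation vectors, where elimination and
  the zeta system apply.\<close>

lemma int_independent_iff:
  fixes S :: "'x::{finite, bounded_lattice} int_mpoly set set"
  assumes "\<And>s. s \<in> S \<Longrightarrow> s = measure_class (r s)"
  shows "int_independent measure_ring S \<longleftrightarrow>
    (\<forall>c. (\<forall>p. join_prime p \<longrightarrow> (\<Sum>s\<in>S. c s * filter_eval p (r s)) = 0) \<longrightarrow> (\<forall>s\<in>S. c s = 0))"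
proof -
  interpret ring_hom_ring int_mpoly_ring measure_ring "measure_class :: 'x int_mpoly \<Rightarrow> _"
    by (rule measure_class_hom)
  have "(\<Oplus>\<^bsub>measure_ring\<^esub>s\<in>S. [c s] \<cdot>\<^bsub>measure_ring\<^esub> s) = measure_class (\<Sum>s\<in>S. of_int (c s) * r s)"
    for c :: "_ \<Rightarrow> int"
    unfolding measure_class_combination
  proof (rule S.finsum_cong')
    show "(\<lambda>s. [c s] \<cdot>\<^bsub>measure_ring\<^esub> measure_class (r s)) \<in> S \<rightarrow> carrier measure_ring"
      using hom_closed by auto
    show "[c s] \<cdot>\<^bsub>measure_ring\<^esub> s = [c s] \<cdot>\<^bsub>measure_ring\<^esub> measure_class (r s)" if "s \<in> S" for s
      using assms[OF that] by simp
  qed simp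
  then show ?thesis
    by (simp add: int_independent_def measure_class_eq_zero_iff lattice_ideal_iff
        filter_eval_combination)
qed

lemma measurability_eq_card_join_prime:
  "measurability TYPE('x::{finite, bounded_lattice}) = enat (card (Collect join_prime :: 'x set))"
proof -
  interpret ring_hom_ring int_mpoly_ring measure_ring "measure_class :: 'x int_mpoly \<Rightarrow> _"
    by (rule measure_class_hom)
  \<comment> \<open>Upper bound: more classes than join-primes would have linearly dependent
    evaluation vectors.\<close>
  have "enat (card S) \<le> enat (card (Collect join_prime :: 'x set))"
    if S: "finite S" "S \<subseteq> carrier measure_ring" "int_independent measure_ring S"
    for S :: "'x int_mpoly set set"
  proof (rule ccontr)
    assume "\<not> ?thesis"
    then have card: "card (Collect join_prime :: 'x set) < card S"
      by simp
    have "\<exists>f. s = measure_class f" if "s \<in> S" for s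
      using that S(2) by (auto simp: FactRing_def A_RCOSETS_def')
    then obtain r where r: "\<And>s. s \<in> S \<Longrightarrow> s = measure_class (r s)"
      by metis
    obtain c where "\<exists>s\<in>S. c s \<noteq> 0"
      "\<forall>p\<in>Collect join_prime. (\<Sum>s\<in>S. c s * filter_eval p (r s)) = 0"
      using int_vectors_dependent[OF _ S(1) card, of "\<lambda>s p. filter_eval p (r s)"] by auto
    then show False
      using S(3) int_independent_iff[of S r, OF r] by auto
  qed
  \<comment> \<open>Lower bound: the classes of the join-prime variables attain it.\<close>
  moreover have "\<exists>S :: 'x int_mpoly set set. finite S \<and> S \<subseteq> carrier measure_ring \<and>
    int_independent measure_ring S \<and> card S = card (Collect join_prime :: 'x set)"
  proof -
    let ?g = "\<lambda>p :: 'x. measure_class (Var p)"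
    \<comment> \<open>Independence and cardinality refer to a set of classes, so distinct
      join-primes must give distinct classes.\<close>
    have inj: "inj_on ?g (Collect join_prime)"
    proof (rule inj_onI)
      fix p q :: 'x assume pq: "p \<in> Collect join_prime" "q \<in> Collect join_prime" "?g p = ?g q"
      interpret I: ideal "lattice_ideal :: 'x int_mpoly set" int_mpoly_ring
        by (rule ideal_lattice_ideal)
      have "Var p \<in> ?g q"
        using I.a_rcos_self[of "Var p"] pq(3) by simp
      then obtain h where "h \<in> lattice_ideal" "Var p = h + Var q"
        by (auto simp: a_r_coset_def')
      then have "filter_eval r (Var p) = filter_eval r (Var q)" if "join_prime r" for r
        using filter_eval_lattice_ideal[OF that] by (simp add: filter_eval_add)
      \<comment> \<open>Evaluating at \<open>p\<close> gives \<open>p \<le> q\<close>, and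
        evaluating at \<open>q\<close> gives \<open>q \<le> p\<close>.\<close>
      from this[of p] this[of q] pq(1,2) show "p = q"
        by (simp add: of_bool_def split: if_splits)
    qed
    let ?S = "?g ` Collect join_prime"
    let ?r = "Var \<circ> the_inv_into (Collect join_prime) ?g"
    have inv: "the_inv_into (Collect join_prime) ?g (?g p) = p" if "join_prime p" for p
      using the_inv_into_f_f[OF inj] that by simp
    have "int_independent measure_ring ?S"
    proof (subst int_independent_iff[of _ ?r])
      show "\<forall>c. (\<forall>p. join_prime p \<longrightarrow> (\<Sum>s\<in>?S. c s * filter_eval p (?r s)) = 0) \<longrightarrow>
          (\<forall>s\<in>?S. c s = 0)"
        \<comment> \<open>Reindexed along \<open>inj\<close>, the condition is the zeta system whose
          unknown at \<open>p\<close> is the coefficient of the class of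
          \<open>Var p\<close>.\<close>
        using zeta_injective[of "Collect join_prime" "\<lambda>p. _ (?g p)"]
        by (auto simp: sum.reindex[OF inj] inv)
    qed (auto simp: inv)
    then show ?thesis
      using hom_closed card_image[OF inj] by (intro exI[of _ ?S]) auto
  qed
  ultimately show ?thesis
    unfolding measurability_def int_rank_def
    by (intro antisym SUP_least) (auto intro: SUP_upper2)
qed

text \<open>An atom lies below the join of the other two atoms, and the top below the join of any
  two, but neither lies below one of the joinands.\<close>

lemma no_join_prime_m3: "\<not> join_prime (p :: m3)"
proof
  assume p: "join_prime p"
  show False
    using p join_prime_le_sup_iff[OF p, of M3_x1 M3_x2] join_prime_le_sup_iff[OF p, of M3_x1 M3_x3]
      join_prime_le_sup_iff[OF p, of M3_x2 M3_x3]
    by (cases p) (auto simp: join_prime_def sup_m3_def less_eq_m3_def bot_m3_def)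
qed

lemma measurability_m3: "measurability TYPE(m3) = 0"
  by (simp add: measurability_eq_card_join_prime no_join_prime_m3 zero_enat_def)

section \<open>Measures\<close>

lemma join_prime_le_Sup_fin_iff:
  assumes "join_prime p" "finite S" "S \<noteq> {}"
  shows "p \<le> Sup_fin S \<longleftrightarrow> (\<exists>x\<in>S. p \<le> x)"
  using assms(2,3)
  by (induction S rule: finite_ne_induct) (simp_all add: join_prime_le_sup_iff[OF assms(1)])

lemma (in abelian_group) add_pow_zero_int [simp]: "[(0::int)] \<cdot>\<^bsub>G\<^esub> b = \<zero>"
  by (simp add: add_pow_int_ge)

lemma (in abelian_group) finsum_add_pow:
  fixes c :: "'s \<Rightarrow> int"
  assumes "b \<in> carrier G"
  shows "(\<Oplus>s\<in>S. [c s] \<cdot>\<^bsub>G\<^esub> b) = [(\<Sum>s\<in>S. c s)] \<cdot>\<^bsub>G\<^esub> b"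
  using assms
  by (induction S rule: infinite_finite_induct) (simp_all add: add.int_pow_mult Pi_def)

text \<open>The full alternating sum of binomial coefficients vanishes for positive
  \<open>m\<close>; dropping its term at \<open>s = 0\<close> and changing sign leaves one. Terms
  with \<open>s > m\<close> are zero, so the range may extend to \<open>k\<close>.\<close>

lemma alternating_sum_choose_from_one:
  assumes "m \<le> k"
  shows "(\<Sum>s=1..k. int (m choose s) * (-1) ^ (s + 1)) = of_bool (m > 0)"
proof -
  have "(\<Sum>s=1..k. int (m choose s) * (-1) ^ (s + 1)) =
      (\<Sum>s=1..m. int (m choose s) * (-1) ^ (s + 1))"
    using assms by (intro sum.mono_neutral_right) auto
  also have "\<dots> = 1 - (\<Sum>s\<le>m. (-1) ^ s * int (m choose s))"
    by (simp add: atMost_atLeast0 sum.atLeast_Suc_atMost sum_negf mult.commute)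
  also have "\<dots> = of_bool (m > 0)"
    by (cases "m = 0") (simp_all add: choose_alternating_sum)
  finally show ?thesis .
qed

text \<open>Let \<open>K\<close> collect the indices \<open>j\<close> with
  \<open>p \<le> x j\<close>. An index set contributes \<open>b\<close> exactly when it is contained
  in \<open>K\<close>, so level \<open>s\<close> counts the \<open>s\<close>-subsets of
  \<open>K\<close>. The alternating sum is one if \<open>K\<close> is nonempty and zero otherwise,
  and by join-primality nonemptiness means that \<open>p\<close> lies below the whole join.\<close>

lemma lattice_measure_indicator:
  fixes B :: "('a, 'b, 'm) module_scheme"
  assumes "abelian_group B" and p: "join_prime p" and b: "b \<in> carrier B"
  shows "lattice_measure B (\<lambda>x. if p \<le> x then b else \<zero>\<^bsub>B\<^esub>)" (is "lattice_measure B ?\<nu>")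
proof -
  interpret abelian_group B by fact
  have "?\<nu> (Sup_fin (x ` {1..k})) =
      (\<Oplus>\<^bsub>B\<^esub>s\<in>{1..k}. [((-1::int) ^ (s + 1))] \<cdot>\<^bsub>B\<^esub>
        (\<Oplus>\<^bsub>B\<^esub>J\<in>{J. J \<subseteq> {1..k} \<and> card J = s}. ?\<nu> (Inf_fin (x ` J))))"
    if "k \<ge> 2" for k x
  proof -
    define K where "K = {j \<in> {1..k}. p \<le> x j}"
    have "K \<subseteq> {1..k}"
      by (auto simp: K_def)
    then have [simp]: "finite K" and "card K \<le> k"
      using card_mono[of "{1..k}" K] finite_subset by auto
    have "(\<Oplus>\<^bsub>B\<^esub>J\<in>{J. J \<subseteq> {1..k} \<and> card J = s}. ?\<nu> (Inf_fin (x ` J))) =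
        [(int (card K choose s))] \<cdot>\<^bsub>B\<^esub> b" if "s \<in> {1..k}" for s
    proof -
      let ?F = "{J. J \<subseteq> {1..k} \<and> card J = s}"
      have le_iff: "p \<le> Inf_fin (x ` J) \<longleftrightarrow> J \<subseteq> K" if "J \<in> ?F" for J
      proof -
        \<comment> \<open>Starting at \<open>s = 1\<close> keeps \<open>J\<close> nonempty, as the
          characterization of lower bounds of \<open>Inf_fin\<close> demands.\<close>
        have "finite J" "J \<noteq> {}"
          using that \<open>s \<in> {1..k}\<close> finite_subset[of J "{1..k}"] by auto
        then show ?thesis
          using that by (auto simp: Inf_fin.bounded_iff K_def)
      qed
      have "(\<Oplus>\<^bsub>B\<^esub>J\<in>?F. ?\<nu> (Inf_fin (x ` J))) = (\<Oplus>\<^bsub>B\<^esub>J\<in>?F. [(of_bool (J \<subseteq> K) :: int)] \<cdot>\<^bsub>B\<^esub> b)"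
        using b le_iff by (intro finsum_cong') auto
      also have "\<dots> = [(\<Sum>J\<in>?F. of_bool (J \<subseteq> K) :: int)] \<cdot>\<^bsub>B\<^esub> b"
        using b by (rule finsum_add_pow)
      also have "(\<Sum>J\<in>?F. of_bool (J \<subseteq> K) :: int) = int (card {J \<in> ?F. J \<subseteq> K})"
        by (simp add: Int_def)
      also have "{J \<in> ?F. J \<subseteq> K} = {J. J \<subseteq> K \<and> card J = s}"
        by (auto simp: K_def)
      finally show ?thesis
        by (simp add: n_subsets)
    qed
    then have "(\<Oplus>\<^bsub>B\<^esub>s\<in>{1..k}. [((-1::int) ^ (s + 1))] \<cdot>\<^bsub>B\<^esub>
        (\<Oplus>\<^bsub>B\<^esub>J\<in>{J. J \<subseteq> {1..k} \<and> card J = s}. ?\<nu> (Inf_fin (x ` J)))) =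
        (\<Oplus>\<^bsub>B\<^esub>s\<in>{1..k}. [(int (card K choose s) * (-1) ^ (s + 1))] \<cdot>\<^bsub>B\<^esub> b)"
      using b by (intro finsum_cong') (auto simp: add.int_pow_pow)
    also have "\<dots> = [(of_bool (card K > 0) :: int)] \<cdot>\<^bsub>B\<^esub> b"
      using b alternating_sum_choose_from_one[OF \<open>card K \<le> k\<close>] by (simp add: finsum_add_pow)
    also have "card K > 0 \<longleftrightarrow> p \<le> Sup_fin (x ` {1..k})"
      using that by (subst join_prime_le_Sup_fin_iff[OF p]) (auto simp: card_gt_0_iff K_def)
    finally show ?thesis
      using b by auto
  qed
  moreover have "\<not> p \<le> Orderings.bot"
    using p by (simp add: join_prime_def bot_unique)
  ultimately show ?thesis
    using b by (auto simp: lattice_measure_def)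
qed

lemma lattice_measure_add:
  fixes B :: "('a, 'b, 'm) module_scheme"
  assumes "abelian_group B" and \<mu>: "lattice_measure B \<mu>" and \<nu>: "lattice_measure B \<nu>"
  shows "lattice_measure B (\<lambda>x. \<mu> x \<oplus>\<^bsub>B\<^esub> \<nu> x)"
proof -
  interpret abelian_group B by fact
  have [simp]: "\<mu> x \<in> carrier B" "\<nu> x \<in> carrier B" for x
    using \<mu> \<nu> by (simp_all add: lattice_measure_def)
  show ?thesis
    using \<mu> \<nu> unfolding lattice_measure_def
    by (simp add: finsum_addf add.int_pow_distrib Pi_def)
qed

section \<open>Inclusion-exclusion for two and three elements\<close>

lemma subsets_of_two:
  "{J. J \<subseteq> {1, 2::nat} \<and> card J = 1} = {{1}, {2}}"
  "{J. J \<subseteq> {1, 2::nat} \<and> card J = 2} = {{1, 2}}"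
proof -
  have *: "J \<subseteq> {1, 2::nat} \<longleftrightarrow> J = {} \<or> J = {1} \<or> J = {2} \<or> J = {1, 2}" for J
    unfolding Pow_iff[symmetric] by (auto simp: Pow_insert)
  show "{J. J \<subseteq> {1, 2::nat} \<and> card J = 1} = {{1}, {2}}"
    "{J. J \<subseteq> {1, 2::nat} \<and> card J = 2} = {{1, 2}}"
    unfolding * by (simp_all add: conj_disj_distribR Collect_disj_eq Collect_conv_if insert_commute)
qed

lemma subsets_of_three:
  "{J. J \<subseteq> {1, 2, 3::nat} \<and> card J = 1} = {{1}, {2}, {3}}"
  "{J. J \<subseteq> {1, 2, 3::nat} \<and> card J = 2} = {{1, 2}, {1, 3}, {2, 3}}"
  "{J. J \<subseteq> {1, 2, 3::nat} \<and> card J = 3} = {{1, 2, 3}}"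
proof -
  have *: "J \<subseteq> {1, 2, 3::nat} \<longleftrightarrow> J = {} \<or> J = {3} \<or> J = {2} \<or> J = {2, 3} \<or>
      J = {1} \<or> J = {1, 3} \<or> J = {1, 2} \<or> J = {1, 2, 3}" for J
    unfolding Pow_iff[symmetric] by (simp add: Pow_insert disj_ac)
  show "{J. J \<subseteq> {1, 2, 3::nat} \<and> card J = 1} = {{1}, {2}, {3}}"
    "{J. J \<subseteq> {1, 2, 3::nat} \<and> card J = 2} = {{1, 2}, {1, 3}, {2, 3}}"
    "{J. J \<subseteq> {1, 2, 3::nat} \<and> card J = 3} = {{1, 2, 3}}"
    unfolding *
    by (simp_all add: conj_disj_distribR Collect_disj_eq Collect_conv_if insert_commute)
qed

lemma lattice_measure_inclusion_exclusion:
  assumes "lattice_measure B \<nu>" "k \<ge> 2"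
  shows "\<nu> (Sup_fin (x ` {1..k})) =
    (\<Oplus>\<^bsub>B\<^esub>s\<in>{1..k}. [((-1::int) ^ (s + 1))] \<cdot>\<^bsub>B\<^esub>
      (\<Oplus>\<^bsub>B\<^esub>J\<in>{J. J \<subseteq> {1..k} \<and> card J = s}. \<nu> (Inf_fin (x ` J))))"
  using assms unfolding lattice_measure_def by blast

text \<open>The case \<open>k = 2\<close>, with the negative term moved across so that later steps
  only rearrange and cancel sums.\<close>

lemma lattice_measure_sup:
  fixes B :: "('a, 'b, 'm) module_scheme"
  assumes "abelian_group B" and \<nu>: "lattice_measure B \<nu>"
  shows "\<nu> (sup x y) \<oplus>\<^bsub>B\<^esub> \<nu> (inf x y) = \<nu> x \<oplus>\<^bsub>B\<^esub> \<nu> y"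
proof -
  interpret abelian_group B by fact
  have closed [simp]: "\<nu> u \<in> carrier B" for u
    using \<nu> by (simp add: lattice_measure_def)
  define f where "f = (\<lambda>i::nat. if i = 1 then x else y)"
  define g where "g s = (\<Oplus>\<^bsub>B\<^esub>J\<in>{J. J \<subseteq> {1, 2} \<and> card J = s}. \<nu> (Inf_fin (f ` J)))" for s
  have interval: "{1..2::nat} = {1, 2}" by auto
  have g: "g 1 = \<nu> x \<oplus>\<^bsub>B\<^esub> \<nu> y" "g 2 = \<nu> (inf x y)"
    unfolding g_def subsets_of_two by (simp_all add: Pi_def f_def inf_commute)
  have "\<nu> (Sup_fin (f ` {1, 2})) = (\<Oplus>\<^bsub>B\<^esub>s\<in>{1, 2}. [((-1::int) ^ (s + 1))] \<cdot>\<^bsub>B\<^esub> g s)"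
    using lattice_measure_inclusion_exclusion[OF \<nu>, of 2 f] unfolding interval g_def by simp
  also have "Sup_fin (f ` {1, 2}) = sup x y"
    by (simp add: f_def sup_commute)
  finally have "\<nu> (sup x y) = (\<nu> x \<oplus>\<^bsub>B\<^esub> \<nu> y) \<oplus>\<^bsub>B\<^esub> \<ominus>\<^bsub>B\<^esub> \<nu> (inf x y)"
    using g by (simp add: Pi_def add.int_pow_neg)
  then show ?thesis
    by (simp add: a_assoc l_neg)
qed

lemma lattice_measure_sup3:
  fixes B :: "('a, 'b, 'm) module_scheme"
  assumes "abelian_group B" and \<nu>: "lattice_measure B \<nu>"
  shows "\<nu> (sup x (sup y z)) \<oplus>\<^bsub>B\<^esub> (\<nu> (inf x y) \<oplus>\<^bsub>B\<^esub> (\<nu> (inf x z) \<oplus>\<^bsub>B\<^esub> \<nu> (inf y z))) =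
    (\<nu> x \<oplus>\<^bsub>B\<^esub> (\<nu> y \<oplus>\<^bsub>B\<^esub> \<nu> z)) \<oplus>\<^bsub>B\<^esub> \<nu> (inf x (inf y z))"
proof -
  interpret abelian_group B by fact
  have closed [simp]: "\<nu> u \<in> carrier B" for u
    using \<nu> by (simp add: lattice_measure_def)
  define f where "f = (\<lambda>i::nat. if i = 1 then x else if i = 2 then y else z)"
  define g where "g s = (\<Oplus>\<^bsub>B\<^esub>J\<in>{J. J \<subseteq> {1, 2, 3} \<and> card J = s}. \<nu> (Inf_fin (f ` J)))" for s
  have interval: "{1..3::nat} = {1, 2, 3}" by auto
  have f: "f 1 = x" "f 2 = y" "f 3 = z"
    by (simp_all add: f_def)
  \<comment> \<open>The sum over pairs splits into three terms only once the pairs are known to be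
    different sets.\<close>
  have distinct: "{1, 2} \<notin> {{1, 3}, {2, 3::nat}}" "{1, 3} \<notin> {{2, 3::nat}}"
    by (simp_all add: doubleton_eq_iff)
  have g1: "g 1 = \<nu> x \<oplus>\<^bsub>B\<^esub> (\<nu> y \<oplus>\<^bsub>B\<^esub> \<nu> z)"
    unfolding g_def subsets_of_three using f by (simp add: Pi_def)
  have g2: "g 2 = \<nu> (inf x y) \<oplus>\<^bsub>B\<^esub> (\<nu> (inf x z) \<oplus>\<^bsub>B\<^esub> \<nu> (inf y z))"
    unfolding g_def subsets_of_three using f distinct by (simp add: Pi_def inf_commute)
  have g3: "g 3 = \<nu> (inf x (inf y z))"
    unfolding g_def subsets_of_three using f by (simp add: inf_commute inf_left_commute)
  have "\<nu> (Sup_fin (f ` {1, 2, 3})) = (\<Oplus>\<^bsub>B\<^esub>s\<in>{1, 2, 3}. [((-1::int) ^ (s + 1))] \<cdot>\<^bsub>B\<^esub> g s)"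
    using lattice_measure_inclusion_exclusion[OF \<nu>, of 3 f] unfolding interval g_def by simp
  also have "Sup_fin (f ` {1, 2, 3}) = sup x (sup y z)"
    using f by (simp add: sup_commute sup_left_commute)
  also have "(\<Oplus>\<^bsub>B\<^esub>s\<in>{1, 2, 3}. [((-1::int) ^ (s + 1))] \<cdot>\<^bsub>B\<^esub> g s) =
      g 1 \<oplus>\<^bsub>B\<^esub> (\<ominus>\<^bsub>B\<^esub> g 2 \<oplus>\<^bsub>B\<^esub> g 3)"
    using g1 g2 g3 by (simp add: Pi_def add.int_pow_neg)
  finally have "\<nu> (sup x (sup y z)) \<oplus>\<^bsub>B\<^esub> g 2 = g 1 \<oplus>\<^bsub>B\<^esub> g 3 \<oplus>\<^bsub>B\<^esub> (\<ominus>\<^bsub>B\<^esub> g 2 \<oplus>\<^bsub>B\<^esub> g 2)"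
    using g1 g2 g3 by (simp add: a_ac)
  moreover have "\<ominus>\<^bsub>B\<^esub> g 2 \<oplus>\<^bsub>B\<^esub> g 2 = \<zero>\<^bsub>B\<^esub>"
    using g2 by (intro l_neg) simp
  ultimately show ?thesis
    using g1 g2 g3 by simp
qed

text \<open>A measure behaves as if meets distributed over joins, even where the lattice does not.
  After \<open>?u\<close> and \<open>?yz\<close> are added, both sides equal the sum of the values
  at \<open>x\<close>, \<open>y\<close>, \<open>z\<close> and the triple meet: the left by two uses
  of the case \<open>k = 2\<close>, the right by the case \<open>k = 3\<close>.\<close>

lemma lattice_measure_inf_sup:
  fixes B :: "('a, 'b, 'm) module_scheme"
  assumes B: "abelian_group B" and \<nu>: "lattice_measure B \<nu>"
  shows "\<nu> (inf x (sup y z)) \<oplus>\<^bsub>B\<^esub> \<nu> (inf (inf x y) z) = \<nu> (inf x y) \<oplus>\<^bsub>B\<^esub> \<nu> (inf x z)"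
proof -
  interpret abelian_group B by fact
  have closed [simp]: "\<nu> u \<in> carrier B" for u
    using \<nu> by (simp add: lattice_measure_def)
  let ?u = "\<nu> (sup x (sup y z))" and ?d = "\<nu> (inf x (sup y z))"
    and ?xy = "\<nu> (inf x y)" and ?xz = "\<nu> (inf x z)" and ?yz = "\<nu> (inf y z)"
    and ?xyz = "\<nu> (inf (inf x y) z)"
  have "(?u \<oplus>\<^bsub>B\<^esub> ?yz) \<oplus>\<^bsub>B\<^esub> (?d \<oplus>\<^bsub>B\<^esub> ?xyz) = (?u \<oplus>\<^bsub>B\<^esub> ?d) \<oplus>\<^bsub>B\<^esub> (?yz \<oplus>\<^bsub>B\<^esub> ?xyz)"
    by (simp add: a_ac)
  also have "?u \<oplus>\<^bsub>B\<^esub> ?d = \<nu> x \<oplus>\<^bsub>B\<^esub> \<nu> (sup y z)"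
    by (rule lattice_measure_sup[OF B \<nu>])
  also have "(\<nu> x \<oplus>\<^bsub>B\<^esub> \<nu> (sup y z)) \<oplus>\<^bsub>B\<^esub> (?yz \<oplus>\<^bsub>B\<^esub> ?xyz) =
      (\<nu> x \<oplus>\<^bsub>B\<^esub> (\<nu> (sup y z) \<oplus>\<^bsub>B\<^esub> ?yz)) \<oplus>\<^bsub>B\<^esub> ?xyz"
    by (simp add: a_ac)
  also have "\<nu> (sup y z) \<oplus>\<^bsub>B\<^esub> ?yz = \<nu> y \<oplus>\<^bsub>B\<^esub> \<nu> z"
    by (rule lattice_measure_sup[OF B \<nu>])
  also have "(\<nu> x \<oplus>\<^bsub>B\<^esub> (\<nu> y \<oplus>\<^bsub>B\<^esub> \<nu> z)) \<oplus>\<^bsub>B\<^esub> ?xyz = ?u \<oplus>\<^bsub>B\<^esub> (?xy \<oplus>\<^bsub>B\<^esub> (?xz \<oplus>\<^bsub>B\<^esub> ?yz))"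
    using lattice_measure_sup3[OF B \<nu>, of x y z] by (simp add: inf_assoc)
  also have "\<dots> = (?u \<oplus>\<^bsub>B\<^esub> ?yz) \<oplus>\<^bsub>B\<^esub> (?xy \<oplus>\<^bsub>B\<^esub> ?xz)"
    by (simp add: a_ac)
  finally show ?thesis
    by simp
qed

lemma lattice_measure_eqI:
  fixes B :: "('a, 'b, 'm) module_scheme" and \<mu> \<nu> :: "'x::{finite, bounded_lattice} \<Rightarrow> 'b"
  assumes B: "abelian_group B" and \<mu>: "lattice_measure B \<mu>" and \<nu>: "lattice_measure B \<nu>"
    and eq: "\<And>p. join_prime p \<Longrightarrow> \<mu> p = \<nu> p"
  shows "\<mu> = \<nu>"
proof
  interpret abelian_group B by fact
  have closed [simp]: "\<mu> u \<in> carrier B" "\<nu> u \<in> carrier B" for u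
    using \<mu> \<nu> by (simp_all add: lattice_measure_def)
  fix x show "\<mu> x = \<nu> x"
  proof (induction x rule: join_prime_induct)
    case bot
    then show ?case using \<mu> \<nu> by (simp add: lattice_measure_def)
  next
    case (cover x y z)
    \<comment> \<open>Both measures satisfy the same relation at \<open>x\<close>, and the induction
      hypotheses identify the meet terms, so the triple meet cancels.\<close>
    have "\<mu> x \<oplus>\<^bsub>B\<^esub> \<mu> (inf (inf x y) z) = \<nu> x \<oplus>\<^bsub>B\<^esub> \<mu> (inf (inf x y) z)"
      using lattice_measure_inf_sup[OF B \<mu>, of x y z] lattice_measure_inf_sup[OF B \<nu>, of x y z]
        cover by (simp add: inf_absorb1)
    then show ?case by simp
  qed (rule eq)
qed

text \<open>Back substitution in the unitriangular system: a maximal \<open>p\<close> of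
  \<open>T\<close> is removed, the rest is solved, and a multiple of the indicator of
  \<open>p\<close> is added. No other element of \<open>T\<close> lies above \<open>p\<close>, so
  the values already prescribed survive.\<close>

lemma lattice_measure_extension:
  fixes B :: "('a, 'b, 'm) module_scheme" and T :: "'x::bounded_lattice set"
  assumes B: "abelian_group B" and "finite T" and "\<And>p. p \<in> T \<Longrightarrow> join_prime p"
    and "\<And>p. p \<in> T \<Longrightarrow> b p \<in> carrier B"
  shows "\<exists>\<nu>. lattice_measure B \<nu> \<and> (\<forall>p\<in>T. \<nu> p = b p)"
  using assms(2-)
proof (induction T rule: finite_psubset_induct)
  case (psubset T)
  interpret abelian_group B by fact
  show ?case
  proof (cases "T = {}")
    case True
    have "lattice_measure B (\<lambda>_ :: 'x. \<zero>\<^bsub>B\<^esub>)"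
      by (simp add: lattice_measure_def)
    then show ?thesis
      using True by blast
  next
    case False
    then obtain p where p: "p \<in> T" and max: "\<And>q. q \<in> T \<Longrightarrow> p \<le> q \<Longrightarrow> p = q"
      using finite_has_maximal[OF psubset.hyps] by blast
    obtain \<nu> where \<nu>: "lattice_measure B \<nu>" and eq: "\<And>q. q \<in> T - {p} \<Longrightarrow> \<nu> q = b q"
      using psubset.IH[of "T - {p}"] psubset.prems p by blast
    have closed [simp]: "\<nu> u \<in> carrier B" "b p \<in> carrier B" for u
      using \<nu> psubset.prems p by (simp_all add: lattice_measure_def)
    let ?\<nu> = "\<lambda>x. \<nu> x \<oplus>\<^bsub>B\<^esub> (if p \<le> x then b p \<ominus>\<^bsub>B\<^esub> \<nu> p else \<zero>\<^bsub>B\<^esub>)"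
    have "lattice_measure B ?\<nu>"
      using psubset.prems(1)[OF p]
      by (intro lattice_measure_add[OF B \<nu>] lattice_measure_indicator[OF B]) simp_all
    moreover have "?\<nu> q = b q" if "q \<in> T" for q
    proof (cases "q = p")
      case True
      then show ?thesis
        by (simp add: a_minus_def a_comm[of "b p"] r_neg2 r_neg1)
    next
      case False
      then show ?thesis
        using max[OF that] eq[of q] that psubset.prems(2) by auto
    qed
    ultimately show ?thesis by blast
  qed
qed

lemma measure_module_isomorphic_mod_power:
  fixes A :: "('a, 'r) ring_scheme" and B :: "('a, 'b, 'm) module_scheme"
  assumes "abelian_group B"
  shows "mod_isomorphic A (measure_module TYPE('x::{finite, bounded_lattice}) B)
    (mod_power B (card (Collect join_prime :: 'x set)))"
proof -
  let ?P = "Collect join_prime :: 'x set"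
  let ?n = "card ?P"
  obtain e where e: "bij_betw e {..<?n} ?P"
    using ex_bij_betw_nat_finite[of ?P] by (auto simp: atLeast0LessThan)
  then have jp: "join_prime (e i)" if "i < ?n" for i
    using that by (auto simp: bij_betw_def)
  \<comment> \<open>The isomorphism restricts a measure to the join-primes, listed as a tuple by
    \<open>e\<close>.\<close>
  let ?f = "\<lambda>\<nu>. \<lambda>i\<in>{..<?n}. \<nu> (e i)"
  have "?f \<in> mod_homs A (measure_module TYPE('x) B) (mod_power B ?n)"
    by (auto simp: mod_homs_def measure_module_def mod_power_def lattice_measure_def
        intro!: restrict_ext)
  moreover have "bij_betw ?f (carrier (measure_module TYPE('x) B)) (carrier (mod_power B ?n))"
  proof (rule bij_betw_imageI)
    show "inj_on ?f (carrier (measure_module TYPE('x) B))"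
    proof (rule inj_onI)
      fix \<mu> \<nu> assume *: "\<mu> \<in> carrier (measure_module TYPE('x) B)"
        "\<nu> \<in> carrier (measure_module TYPE('x) B)" and eq: "?f \<mu> = ?f \<nu>"
      have "\<mu> p = \<nu> p" if p: "join_prime p" for p
      proof -
        obtain i where i: "i < ?n" "p = e i"
          using e p by (metis bij_betw_def imageE lessThan_iff mem_Collect_eq)
        then show ?thesis
          using fun_cong[OF eq, of i] by simp
      qed
      then show "\<mu> = \<nu>"
        using * by (intro lattice_measure_eqI[OF assms]) (simp_all add: measure_module_def)
    qed
    show "?f ` carrier (measure_module TYPE('x) B) = carrier (mod_power B ?n)"
    proof
      show "?f ` carrier (measure_module TYPE('x) B) \<subseteq> carrier (mod_power B ?n)"
        by (auto simp: measure_module_def mod_power_def lattice_measure_def split: if_splits)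
      show "carrier (mod_power B ?n) \<subseteq> ?f ` carrier (measure_module TYPE('x) B)"
      proof
        fix u assume u: "u \<in> carrier (mod_power B ?n)"
        let ?b = "\<lambda>p. u (the_inv_into {..<?n} e p)"
        have inv: "the_inv_into {..<?n} e p < ?n" if "p \<in> ?P" for p
          using that bij_betw_the_inv_into[OF e] by (auto simp: bij_betw_def)
        have "\<exists>\<nu>. lattice_measure B \<nu> \<and> (\<forall>p\<in>?P. \<nu> p = ?b p)"
          using u inv by (intro lattice_measure_extension[OF assms]) (auto simp: mod_power_def)
        then obtain \<nu> where \<nu>: "lattice_measure B \<nu>" "\<And>p. p \<in> ?P \<Longrightarrow> \<nu> p = ?b p"
          by blast
        have "?f \<nu> = u"
        proof
          \<comment> \<open>Inside the index range the prescribed values give equality; outside it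
            both functions are \<open>undefined\<close>, since members of the power are
            extensional.\<close>
          fix i show "?f \<nu> i = u i"
            using u \<nu>(2)[of "e i"] jp[of i] the_inv_into_f_f[OF bij_betw_imp_inj_on[OF e], of i]
            by (auto simp: mod_power_def PiE_def extensional_def)
        qed
        with \<nu>(1) show "u \<in> ?f ` carrier (measure_module TYPE('x) B)"
          by (auto simp: measure_module_def)
      qed
    qed
  qed
  ultimately show ?thesis
    unfolding mod_isomorphic_def by blast
qed

theorem theorem4:
  fixes A :: "('a, 'r) ring_scheme" and B :: "('a, 'b, 'm) module_scheme"
  assumes "module A B"
  shows "(\<exists>n::nat. measurability TYPE('x::{finite, bounded_lattice}) = enat n \<and>
            mod_isomorphic A (measure_module TYPE('x) B) (mod_power B n))
       \<and> measurability TYPE(m3) = 0"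
  using measurability_eq_card_join_prime[where 'x = 'x]
    measure_module_isomorphic_mod_power[OF module.axioms(2)[OF assms], where 'x = 'x]
    measurability_m3
  by blast

end
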